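(* Let $\mathcal{H}_K$ and $\mathcal{H}_M$ be complex Hilbert spaces of finite dimensions $K$ and $M$, and let $A$ be any linear operator on $\mathcal{H}_K\otimes\mathcal{H}_M$. Then $$\frac{1}{KM}\,\mathrm{tr}\,A\ \in\ \Lambda^{\otimes}(A).$$
   Context: For an operator $X$ on $\mathcal{H}_K\otimes\mathcal{H}_M$, the product numerical range is $\Lambda^{\otimes}(X)=\{\langle\psi_A\otimes\psi_B|X|\psi_A\otimes\psi_B\rangle : \psi_A\in\mathcal{H}_K,\ \psi_B\in\mathcal{H}_M,\ \|\psi_A\|=\|\psi_B\|=1\}$. *)

theory Defs
  imports "HOL-Analysis.Analysis"
begin

class scaleC =
  fixes scaleC :: "complex \<Rightarrow> 'a \<Rightarrow> 'a" (infixr \<open>*\<^sub>C\<close> 75)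

class complex_vector = ab_group_add + scaleC +
  assumes scaleC_add_right: "a *\<^sub>C (x + y) = a *\<^sub>C x + a *\<^sub>C y"
    and scaleC_add_left: "(a + b) *\<^sub>C x = a *\<^sub>C x + b *\<^sub>C x"
    and scaleC_scaleC: "a *\<^sub>C b *\<^sub>C x = (a * b) *\<^sub>C x"
    and scaleC_one: "1 *\<^sub>C x = x"

global_interpretation complex_vector:
  vector_space "scaleC :: complex \<Rightarrow> 'a \<Rightarrow> 'a::complex_vector"
  defines cspan_raw_def: cspan = complex_vector.span
    and cdependent_raw_def: cdependent = complex_vector.dependent
    and crepresentation_raw_def: crepresentation = complex_vector.representation
    and cdim_raw_def: cdim = complex_vector.dim
  by unfold_locales (simp_all add: scaleC_add_right scaleC_add_left scaleC_scaleC scaleC_one)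

abbreviation clinear :: "('a::complex_vector \<Rightarrow> 'b::complex_vector) \<Rightarrow> bool"
  where "clinear \<equiv> Vector_Spaces.linear scaleC scaleC"

(* The inner product is linear in the second argument (Dirac convention). *)
class complex_inner = complex_vector +
  fixes cinner :: "'a \<Rightarrow> 'a \<Rightarrow> complex"
  assumes cinner_add_right: "cinner x (y + z) = cinner x y + cinner x z"
    and cinner_scaleC_right: "cinner x (c *\<^sub>C y) = c * cinner x y"
    and cinner_commute: "cinner x y = cnj (cinner y x)"
    and cinner_pos: "x \<noteq> 0 \<Longrightarrow> 0 < Re (cinner x x)"

definition cnorm :: "'a::complex_inner \<Rightarrow> real"
  where "cnorm x = sqrt (Re (cinner x x))"

(* Completeness is automatic in finite dimension. *)
class finite_dim_hilbert = complex_inner +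
  assumes finitely_spanned: "\<exists>B. finite B \<and> (\<forall>x. \<exists>f. x = (\<Sum>b\<in>B. f b *\<^sub>C b))"

lemma finite_spanning_set: "\<exists>B :: 'a::finite_dim_hilbert set. finite B \<and> cspan B = UNIV"
proof -
  obtain B :: "'a set" where B: "finite B" "\<forall>x. \<exists>f. x = (\<Sum>b\<in>B. f b *\<^sub>C b)"
    using finitely_spanned by blast
  then have "cspan B = UNIV"
    by (auto simp: complex_vector.span_finite)
  with B show ?thesis by blast
qed

(* The Hilbert space tensor product of 'a and 'b, determined up to a unitary by these properties:
   tensor x y is the elementary tensor of x and y. *)
definition is_hilbert_tensor ::
    "('a::finite_dim_hilbert \<Rightarrow> 'b::finite_dim_hilbert \<Rightarrow> 'c::finite_dim_hilbert) \<Rightarrow> bool"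
  where "is_hilbert_tensor tensor \<longleftrightarrow>
    (\<forall>x. clinear (\<lambda>y. tensor x y)) \<and>
    (\<forall>y. clinear (\<lambda>x. tensor x y)) \<and>
    (\<forall>x y x' y'. cinner (tensor x y) (tensor x' y') = cinner x x' * cinner y y') \<and>
    cspan {tensor x y |x y. True} = UNIV"

definition ctrace_wrt :: "'a::complex_vector set \<Rightarrow> ('a \<Rightarrow> 'a) \<Rightarrow> complex"
  where "ctrace_wrt B A = (\<Sum>b\<in>B. crepresentation B (A b) b)"

(* The choice of the basis is immaterial: see ctrace_eq. *)
definition ctrace :: "('a::finite_dim_hilbert \<Rightarrow> 'a) \<Rightarrow> complex"
  where "ctrace A = ctrace_wrt (SOME B. \<not> cdependent B \<and> cspan B = UNIV) A"

definition product_numerical_range ::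
    "('a::finite_dim_hilbert \<Rightarrow> 'b::finite_dim_hilbert \<Rightarrow> 'c::finite_dim_hilbert)
      \<Rightarrow> ('c \<Rightarrow> 'c) \<Rightarrow> complex set"
  where "product_numerical_range tensor X =
    {cinner (tensor x y) (X (tensor x y)) |x y. cnorm x = 1 \<and> cnorm y = 1}"

lemma basis_finite:
  fixes B :: "'a::finite_dim_hilbert set"
  assumes "\<not> cdependent B"
  shows "finite B"
proof -
  obtain T :: "'a set" where "finite T" "cspan T = UNIV"
    using finite_spanning_set by blast
  then show ?thesis
    using complex_vector.independent_span_bound[of T B] assms by auto
qed

lemma ctrace_wrt_basis_independent:
  fixes A :: "'a::finite_dim_hilbert \<Rightarrow> 'a"
  assumes A: "clinear A"
    and B: "\<not> cdependent B" "cspan B = UNIV"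
    and C: "\<not> cdependent C" "cspan C = UNIV"
  shows "ctrace_wrt B A = ctrace_wrt C A"
proof -
  interpret A: Vector_Spaces.linear scaleC scaleC A by (rule A)
  have fB: "finite B" and fC: "finite C" using B C basis_finite by auto
  have expand: "(\<Sum>d\<in>D. crepresentation D v d *\<^sub>C d) = v"
    if "\<not> cdependent D" "cspan D = UNIV" "finite D" for D and v :: 'a
    using complex_vector.sum_representation_eq[of D v D] that by auto
  have rep: "crepresentation D (\<Sum>i\<in>I. f i *\<^sub>C g i) b = (\<Sum>i\<in>I. f i * crepresentation D (g i) b)"
    if "\<not> cdependent D" "cspan D = UNIV" for D :: "'a set" and I :: "'a set" and f g b
    using that by (simp add: complex_vector.representation_sum complex_vector.representation_scale)
  have "ctrace_wrt B A = (\<Sum>b\<in>B. crepresentation B (\<Sum>c\<in>C. crepresentation C b c *\<^sub>C A c) b)"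
    unfolding ctrace_wrt_def
    using expand[OF C fC] by (metis (no_types, lifting) A.scale A.sum sum.cong)
  also have "\<dots> = (\<Sum>b\<in>B. \<Sum>c\<in>C. crepresentation C b c * crepresentation B (A c) b)"
    using rep[OF B] by simp
  also have "\<dots> = (\<Sum>c\<in>C. \<Sum>b\<in>B. crepresentation B (A c) b * crepresentation C b c)"
    by (subst sum.swap) (simp add: mult.commute)
  also have "\<dots> = (\<Sum>c\<in>C. crepresentation C (\<Sum>b\<in>B. crepresentation B (A c) b *\<^sub>C b) c)"
    using rep[OF C] by simp
  also have "\<dots> = ctrace_wrt C A"
    unfolding ctrace_wrt_def by (simp add: expand[OF B fB])
  finally show ?thesis .
qed

lemma ctrace_eq:
  fixes A :: "'a::finite_dim_hilbert \<Rightarrow> 'a"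
  assumes "clinear A" "\<not> cdependent B" "cspan B = UNIV"
  shows "ctrace A = (\<Sum>b\<in>B. crepresentation B (A b) b)"
proof -
  let ?S = "SOME B :: 'a set. \<not> cdependent B \<and> cspan B = UNIV"
  have "\<not> cdependent ?S \<and> cspan ?S = UNIV"
    by (rule someI[of _ B]) (use assms in simp)
  then have "ctrace A = ctrace_wrt B A"
    unfolding ctrace_def using assms by (intro ctrace_wrt_basis_independent) auto
  then show ?thesis by (simp add: ctrace_wrt_def)
qed

end

theory Submission
  imports Defs
begin

text \<open>Averaging over an orthonormal basis \<open>f\<close> of the second factor gives the sesquilinear form
  \<open>x, x' \<mapsto> \<Sum>f. \<langle>x \<otimes> f, A (x' \<otimes> f)\<rangle>\<close>. Its numerical range is convex
  (Toeplitz--Hausdorff), so a unit vector \<open>x\<close> attains the mean of its diagonal, which is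
  \<open>tr A / K\<close>. The same argument for the form \<open>y, y' \<mapsto> \<langle>x \<otimes> y, A (x \<otimes> y')\<rangle>\<close>, whose trace is
  now \<open>tr A / K\<close>, gives a unit vector \<open>y\<close>.\<close>

section \<open>Inner products and orthonormal sets\<close>

lemma cinner_add_left: "cinner (x + y) z = cinner x z + cinner y z" for x :: "'a::complex_inner"
  by (metis cinner_add_right cinner_commute complex_cnj_add)

lemma cinner_scaleC_left: "cinner (c *\<^sub>C x) y = cnj c * cinner x y" for x :: "'a::complex_inner"
  by (metis cinner_commute cinner_scaleC_right complex_cnj_mult)

lemma cinner_zero_right [simp]: "cinner x 0 = 0" for x :: "'a::complex_inner"
  using cinner_add_right[of x 0 0] by simp

lemma cinner_diff_right: "cinner x (y - z) = cinner x y - cinner x z" for x :: "'a::complex_inner"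
  using cinner_add_right[of x "y - z" z] by simp

lemma cinner_sum_right: "cinner x (sum g I) = (\<Sum>i\<in>I. cinner x (g i))" for x :: "'a::complex_inner"
  by (induction I rule: infinite_finite_induct) (auto simp: cinner_add_right)

lemma cinner_self_real: "cinner x x = complex_of_real (Re (cinner x x))" for x :: "'a::complex_inner"
  using cinner_commute[of x x] by (simp add: complex_eq_iff)

lemma cnorm_eq_1_iff: "cnorm x = 1 \<longleftrightarrow> cinner x x = 1" for x :: "'a::complex_inner"
  using cinner_self_real[of x] by (simp add: cnorm_def complex_eq_iff)

text \<open>The scalar is the reciprocal of the norm. The first equation rescales values of other
  sesquilinear forms; the second gives the unit vector itself.\<close>

lemma exists_normalization:
  fixes x :: "'a::complex_inner"
  assumes "x \<noteq> 0"
  obtains r :: real where "r > 0" "complex_of_real (r\<^sup>2) * cinner x x = 1"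
    "cinner (complex_of_real r *\<^sub>C x) (complex_of_real r *\<^sub>C x) = 1"
proof -
  define s where "s = Re (cinner x x)"
  have s: "s > 0" "cinner x x = complex_of_real s"
    using cinner_pos[OF assms] cinner_self_real[of x] by (auto simp: s_def)
  define r where "r = 1 / sqrt s"
  have r2: "r\<^sup>2 * s = 1" using s by (simp add: r_def power_divide)
  have "complex_of_real (r\<^sup>2) * cinner x x = 1"
    unfolding s by (metis of_real_1 of_real_mult r2)
  moreover from this have "cinner (complex_of_real r *\<^sub>C x) (complex_of_real r *\<^sub>C x) = 1"
    by (simp add: cinner_scaleC_left cinner_scaleC_right power2_eq_square mult.assoc)
  ultimately show thesis using that[of r] s by (simp add: r_def)
qed

definition orthonormal :: "'a::complex_inner set \<Rightarrow> bool"
  where "orthonormal B \<longleftrightarrow> (\<forall>b\<in>B. \<forall>c\<in>B. cinner b c = (if b = c then 1 else 0))"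

lemma orthonormal_cinner_sum:
  assumes "orthonormal B" "finite B" "b \<in> B"
  shows "cinner b (\<Sum>c\<in>B. f c *\<^sub>C c) = f b"
proof -
  have "cinner b (\<Sum>c\<in>B. f c *\<^sub>C c) = (\<Sum>c\<in>B. if b = c then f c else 0)"
    unfolding cinner_sum_right cinner_scaleC_right
    using assms by (intro sum.cong refl) (auto simp: orthonormal_def)
  then show ?thesis using assms by simp
qed

lemma orthonormal_independent:
  assumes "orthonormal B" "finite B"
  shows "\<not> cdependent B"
proof
  assume "cdependent B"
  then obtain u b where u: "b \<in> B" "u b \<noteq> 0" "(\<Sum>v\<in>B. u v *\<^sub>C v) = 0"
    using assms(2) by (auto simp: complex_vector.dependent_finite)
  then show False using orthonormal_cinner_sum[OF assms u(1), of u] by simp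
qed

lemma orthonormal_representation:
  fixes B :: "'a::finite_dim_hilbert set"
  assumes "orthonormal B" "finite B" "cspan B = UNIV" "b \<in> B"
  shows "crepresentation B v b = cinner b v"
proof -
  have "(\<Sum>c\<in>B. crepresentation B v c *\<^sub>C c) = v"
    using assms orthonormal_independent by (intro complex_vector.sum_representation_eq) auto
  then show ?thesis using orthonormal_cinner_sum[OF assms(1,2,4)] by metis
qed

text \<open>Coordinates in an orthonormal basis are inner products, so the arbitrary basis behind
  \<open>ctrace\<close> can be traded for diagonal values of the form \<open>cinner b (A b)\<close>,
  the kind of value a numerical range consists of.\<close>

lemma ctrace_orthonormal:
  fixes A :: "'a::finite_dim_hilbert \<Rightarrow> 'a"
  assumes "clinear A" "orthonormal B" "finite B" "cspan B = UNIV"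
  shows "ctrace A = (\<Sum>b\<in>B. cinner b (A b))"
  using ctrace_eq[OF assms(1) orthonormal_independent assms(4)] assms
  by (simp add: orthonormal_representation)

lemma gram_schmidt:
  fixes S :: "'a::complex_inner set"
  assumes "finite S"
  shows "\<exists>B. finite B \<and> orthonormal B \<and> cspan B = cspan S"
  using assms
proof (induction S)
  case empty
  show ?case by (intro exI[of _ "{}"]) (simp add: orthonormal_def)
next
  case (insert a S)
  then obtain B where B: "finite B" "orthonormal B" "cspan B = cspan S" by blast
  \<comment> \<open>\<open>p\<close> is the orthogonal projection of \<open>a\<close> onto the span
    of \<open>B\<close>. If \<open>a - p\<close> vanishes, \<open>B\<close> already spans
    everything; otherwise its normalization is the new basis vector.\<close>
  define p where "p = (\<Sum>b\<in>B. cinner b a *\<^sub>C b)"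
  have p: "p \<in> cspan B"
    unfolding p_def
    by (intro complex_vector.span_sum complex_vector.span_scale complex_vector.span_base)
  have orth: "cinner b (a - p) = 0" if "b \<in> B" for b
    using orthonormal_cinner_sum[OF B(2,1) that] by (simp add: p_def cinner_diff_right)
  show ?case
  proof (cases "a - p = 0")
    case True
    then have "cspan (insert a S) = cspan S"
      using p B(3) by (intro complex_vector.span_redundant) simp
    then show ?thesis using B by auto
  next
    case False
    then obtain r where r: "r > 0"
      "cinner (complex_of_real r *\<^sub>C (a - p)) (complex_of_real r *\<^sub>C (a - p)) = 1"
      using exists_normalization by metis
    define e where "e = complex_of_real r *\<^sub>C (a - p)"
    have e: "cinner b e = 0" "cinner e b = 0" if "b \<in> B" for b
      using orth[OF that] cinner_commute[of e b] by (simp_all add: e_def cinner_scaleC_right)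
    have on: "orthonormal (insert e B)"
      using B(2) e r(2) unfolding orthonormal_def e_def[symmetric] by auto
    have "inverse (complex_of_real r) *\<^sub>C e + p = a"
      using r(1) by (simp add: e_def scaleC_scaleC scaleC_one)
    moreover have "inverse (complex_of_real r) *\<^sub>C e + p \<in> cspan (insert e B)"
      by (intro complex_vector.span_add complex_vector.span_scale complex_vector.span_base
          subsetD[OF complex_vector.span_mono p]) auto
    ultimately have a: "a \<in> cspan (insert e B)" by simp
    have e_in: "e \<in> cspan (insert a S)"
      unfolding e_def
      by (intro complex_vector.span_scale complex_vector.span_diff complex_vector.span_base
          subsetD[OF complex_vector.span_mono p[unfolded B(3)]]) auto
    have "S \<subseteq> cspan (insert e B)"
      using complex_vector.span_superset[of S] complex_vector.span_mono[of B "insert e B"] B(3)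
      by auto
    moreover have "B \<subseteq> cspan (insert a S)"
      using complex_vector.span_superset[of B] complex_vector.span_mono[of S "insert a S"] B(3)
      by auto
    ultimately have "cspan (insert e B) = cspan (insert a S)"
      using a e_in by (subst complex_vector.span_eq) auto
    then show ?thesis using on B(1) by blast
  qed
qed

lemma exists_orthonormal_basis:
  obtains B :: "'a::finite_dim_hilbert set"
  where "finite B" "orthonormal B" "cspan B = UNIV" "card B = cdim (UNIV :: 'a set)"
proof -
  obtain B :: "'a set" where B: "finite B" "orthonormal B" "cspan B = UNIV"
    using finite_spanning_set gram_schmidt by metis
  have "card B = cdim (UNIV :: 'a set)"
    using B orthonormal_independent by (intro complex_vector.basis_card_eq_dim) auto
  then show thesis using B that by blast
qed

section \<open>Convexity of the numerical range\<close>

text \<open>Working with forms instead of operators lets the same results serve the inner product,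
  its affine combinations with other forms, and the forms that \<open>A\<close> induces on each
  tensor factor, without constructing operators on the factors.\<close>

locale sesquilinear =
  fixes F :: "'a::complex_inner \<Rightarrow> 'a \<Rightarrow> complex"
  assumes add_left: "F (x + y) z = F x z + F y z"
    and add_right: "F z (x + y) = F z x + F z y"
    and scaleC_left: "F (c *\<^sub>C x) z = cnj c * F x z"
    and scaleC_right: "F z (c *\<^sub>C x) = c * F z x"
begin

lemma expand_comb:
  "F (c *\<^sub>C x + d *\<^sub>C y) (c *\<^sub>C x + d *\<^sub>C y) =
    cnj c * c * F x x + cnj d * d * F y y + (cnj c * d * F x y + cnj d * c * F y x)"
  by (simp add: add_left add_right scaleC_left scaleC_right algebra_simps)

text \<open>Both sides of the equation are multiplied by the same positive factor when
  \<open>z\<close> is rescaled, so a value may be sought among unnormalized nonzero vectors.\<close>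

lemma normalize_value:
  assumes "z \<noteq> 0" "F z z = l * cinner z z"
  shows "\<exists>w. cnorm w = 1 \<and> F w w = l"
proof -
  obtain r :: real where r: "complex_of_real (r\<^sup>2) * cinner z z = 1"
    "cinner (complex_of_real r *\<^sub>C z) (complex_of_real r *\<^sub>C z) = 1"
    using exists_normalization[OF assms(1)] by metis
  have "F (complex_of_real r *\<^sub>C z) (complex_of_real r *\<^sub>C z) = l * (complex_of_real (r\<^sup>2) * cinner z z)"
    using assms(2) by (simp add: scaleC_left scaleC_right power2_eq_square)
  then show ?thesis using r by (auto simp: cnorm_eq_1_iff)
qed

text \<open>Rotating \<open>y\<close> by a suitable phase makes the form real on the real segment from \<open>x\<close> to \<open>y\<close>,
  so the intermediate value theorem applies.\<close>

lemma unit_interval_value: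
  fixes l :: real
  assumes x: "cnorm x = 1" "F x x = 0" and y: "cnorm y = 1" "F y y = 1"
    and l: "0 \<le> l" "l \<le> 1"
  shows "\<exists>z. cnorm z = 1 \<and> F z z = of_real l"
proof -
  have xx: "cinner x x = 1" and yy: "cinner y y = 1" using x y by (auto simp: cnorm_eq_1_iff)
  \<comment> \<open>For every \<open>u\<close>, \<open>w * u\<close> has the same imaginary part as
    the cross term \<open>u * F x y + cnj u * F y x\<close>. The phase \<open>u\<close> turns
    \<open>w\<close> into its modulus; if \<open>w = 0\<close> any phase works.\<close>
  define w where "w = F x y - cnj (F y x)"
  define u where "u = (if w = 0 then 1 else cnj w / of_real (cmod w))"
  have u: "cnj u * u = 1"
  proof (cases "w = 0")
    case False
    then have "cnj u * u = (w * cnj w) / (of_real (cmod w))\<^sup>2"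
      by (simp add: u_def power2_eq_square)
    then show ?thesis using False by (simp add: complex_norm_square[symmetric])
  qed (simp add: u_def)
  have "w * u \<in> \<real>"
  proof (cases "w = 0")
    case False
    then have "w * u = of_real ((cmod w)\<^sup>2) / of_real (cmod w)"
      unfolding complex_norm_square by (simp add: u_def)
    then show ?thesis by simp
  qed simp
  then have "Im (w * u) = 0" by (simp add: complex_is_Real_iff)
  then have cross: "Im (u * F x y + cnj u * F y x) = 0"
    by (simp add: w_def algebra_simps)
  define c where "c = Re (u * F x y + cnj u * F y x)"
  have c: "u * F x y + cnj u * F y x = of_real c"
    using cross by (simp add: c_def complex_eq_iff)
  \<comment> \<open>For the inner product the cross term is real for every phase, its two summands
    being conjugate to each other.\<close>
  define d where "d = Re (u * cinner x y + cnj u * cinner y x)"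
  have d: "u * cinner x y + cnj u * cinner y x = of_real d"
    using cinner_commute[of y x] by (simp add: d_def complex_eq_iff)
  define z where "z t = complex_of_real (1 - t) *\<^sub>C x + (complex_of_real t * u) *\<^sub>C y" for t :: real
  interpret inner: sesquilinear "cinner :: 'a \<Rightarrow> 'a \<Rightarrow> complex"
    by unfold_locales
      (simp_all add: cinner_add_left cinner_add_right cinner_scaleC_left cinner_scaleC_right)
  have Fz: "F (z t) (z t) = of_real (t\<^sup>2 + t * (1 - t) * c)" for t
  proof -
    have "F (z t) (z t) = of_real t ^ 2 * (cnj u * u)
        + of_real t * (1 - of_real t) * (u * F x y + cnj u * F y x)"
      unfolding z_def expand_comb x y by (simp add: power2_eq_square algebra_simps)
    then show ?thesis by (simp only: u c) simp
  qed
  have Iz: "cinner (z t) (z t) = of_real ((1 - t)\<^sup>2 + t\<^sup>2 + t * (1 - t) * d)" for t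
  proof -
    have "cinner (z t) (z t) = (1 - of_real t) ^ 2 + of_real t ^ 2 * (cnj u * u)
        + of_real t * (1 - of_real t) * (u * cinner x y + cnj u * cinner y x)"
      unfolding z_def inner.expand_comb xx yy by (simp add: power2_eq_square algebra_simps)
    then show ?thesis by (simp only: u d) simp
  qed
  \<comment> \<open>A zero of \<open>h\<close> is a point where \<open>F (z t) (z t)\<close> equals
    \<open>l\<close> times the squared norm of \<open>z t\<close>. The endpoint values are
    \<open>-l\<close> and \<open>1 - l\<close>.\<close>
  define h where "h t = t\<^sup>2 + t * (1 - t) * c - l * ((1 - t)\<^sup>2 + t\<^sup>2 + t * (1 - t) * d)" for t
  have "continuous_on {0..1} h"
    unfolding h_def by (intro continuous_intros)
  moreover have "h 0 \<le> 0" "0 \<le> h 1" using l by (simp_all add: h_def)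
  ultimately obtain t where t: "0 \<le> t" "t \<le> 1" "h t = 0"
    using IVT'[of h 0 0 1] by auto
  have "F (z t) (z t) = of_real l * cinner (z t) (z t)"
    using t(3) unfolding Fz Iz of_real_mult[symmetric] h_def by simp
  \<comment> \<open>Otherwise a multiple of \<open>x\<close> equals a multiple of \<open>y\<close>.
    As \<open>F\<close> is 0 at \<open>x\<close> and 1 at \<open>y\<close>, evaluating it on both
    forces \<open>t = 0\<close>, and then \<open>x = 0\<close>.\<close>
  moreover have "z t \<noteq> 0"
  proof
    assume 0: "z t = 0"
    have "complex_of_real (1 - t) *\<^sub>C x = - ((complex_of_real t * u) *\<^sub>C y)"
      using 0 unfolding z_def by (simp add: eq_neg_iff_add_eq_0)
    also have "\<dots> = (- (complex_of_real t * u)) *\<^sub>C y"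
      by simp
    finally have eq: "complex_of_real (1 - t) *\<^sub>C x = (- (complex_of_real t * u)) *\<^sub>C y" .
    have "F (complex_of_real (1 - t) *\<^sub>C x) (complex_of_real (1 - t) *\<^sub>C x) = 0"
      by (simp add: scaleC_left scaleC_right x)
    then have "of_real t ^ 2 * (cnj u * u) = 0"
      unfolding eq
      by (simp add: scaleC_left scaleC_right y power2_eq_square
          del: complex_vector.scale_minus_left)
    then have "t = 0" by (simp add: u)
    then have "x = 0" using eq by (simp add: scaleC_one)
    then show False using xx by simp
  qed
  ultimately show ?thesis using normalize_value by blast
qed

text \<open>An affine map of the complex plane sends two distinct values to 0 and 1 and the segment
  between them to the unit interval, which reduces the claim to
  \<open>unit_interval_value\<close>.\<close>

lemma convex_numerical_range: "convex {F x x |x. cnorm x = 1}"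
proof (rule convexI, clarsimp)
  fix x y :: 'a and s t :: real
  assume x: "cnorm x = 1" and y: "cnorm y = 1" and st: "0 \<le> s" "0 \<le> t" "s + t = 1"
  define a b where "a = F x x" and "b = F y y"
  show "\<exists>z. s *\<^sub>R F x x + t *\<^sub>R F y y = F z z \<and> cnorm z = 1"
  proof (cases "a = b")
    case True
    then have "s *\<^sub>R F x x + t *\<^sub>R F y y = F x x"
      using st by (metis a_def b_def scaleR_add_left scaleR_one)
    then show ?thesis using x by metis
  next
    case False
    \<comment> \<open>Subtracting \<open>a * cinner p q\<close>, not the constant \<open>a\<close>,
      keeps the form sesquilinear and still shifts its values at unit vectors by
      \<open>a\<close>.\<close>
    define G where "G p q = (F p q - a * cinner p q) / (b - a)" for p q
    interpret G: sesquilinear G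
      by unfold_locales (simp_all add: G_def add_left add_right scaleC_left scaleC_right
          cinner_add_left cinner_add_right cinner_scaleC_left cinner_scaleC_right
          add_divide_distrib diff_divide_distrib algebra_simps)
    have "G x x = 0" "G y y = 1"
      using x y False by (simp_all add: G_def cnorm_eq_1_iff a_def b_def)
    then obtain z where z: "cnorm z = 1" "G z z = of_real t"
      using G.unit_interval_value[of x y t] x y st by auto
    then have "F z z - a = of_real t * (b - a)"
      using False by (simp add: G_def cnorm_eq_1_iff field_simps)
    moreover have s: "s = 1 - t" using st by simp
    ultimately have "F z z = s *\<^sub>R a + t *\<^sub>R b"
      unfolding s by (simp add: scaleR_conv_of_real algebra_simps)
    then show ?thesis using z(1) by (metis a_def b_def)
  qed
qed

text \<open>The mean is the convex combination, with equal weights, of the values at the unit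
  vectors in \<open>E\<close>.\<close>

lemma mean_in_numerical_range:
  assumes "finite E" "E \<noteq> {}" "orthonormal E"
  shows "\<exists>x. cnorm x = 1 \<and> F x x = (\<Sum>e\<in>E. F e e) / of_nat (card E)"
proof -
  have "(\<Sum>e\<in>E. (1 / real (card E)) *\<^sub>R F e e) \<in> {F x x |x. cnorm x = 1}"
  proof (rule convex_sum[OF assms(1) convex_numerical_range])
    show "F e e \<in> {F x x |x. cnorm x = 1}" if "e \<in> E" for e
      using assms(3) that by (auto simp: orthonormal_def cnorm_eq_1_iff)
  qed (use assms in auto)
  moreover have "(\<Sum>e\<in>E. (1 / real (card E)) *\<^sub>R F e e) = (\<Sum>e\<in>E. F e e) / of_nat (card E)"
    by (simp add: scaleR_conv_of_real sum_divide_distrib)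
  ultimately show ?thesis by auto
qed

end

section \<open>Tensor products\<close>

text \<open>Orthonormality comes from multiplicativity of the inner product on elementary tensors.
  Injectivity is recorded so that sums over the image can be reindexed by pairs.\<close>

lemma tensor_orthonormal_basis:
  fixes tensor :: "'a::finite_dim_hilbert \<Rightarrow> 'b::finite_dim_hilbert \<Rightarrow> 'c::finite_dim_hilbert"
  assumes t: "is_hilbert_tensor tensor"
    and E: "finite E" "orthonormal E" "cspan E = UNIV"
    and H: "finite H" "orthonormal H" "cspan H = UNIV"
  shows "orthonormal (case_prod tensor ` (E \<times> H))" "inj_on (case_prod tensor) (E \<times> H)"
    "cspan (case_prod tensor ` (E \<times> H)) = UNIV"
proof -
  let ?T = "case_prod tensor ` (E \<times> H)"
  interpret R: Vector_Spaces.linear scaleC scaleC "tensor x" for x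
    using t by (simp add: is_hilbert_tensor_def)
  interpret L: Vector_Spaces.linear scaleC scaleC "\<lambda>x. tensor x y" for y
    using t by (simp add: is_hilbert_tensor_def)
  have inner: "cinner (tensor e f) (tensor e' f') = (if e = e' \<and> f = f' then 1 else 0)"
    if "e \<in> E" "e' \<in> E" "f \<in> H" "f' \<in> H" for e e' f f'
    using t E(2) H(2) that by (auto simp: is_hilbert_tensor_def orthonormal_def)
  show inj: "inj_on (case_prod tensor) (E \<times> H)"
  proof (rule inj_onI, clarify)
    fix e f e' f'
    assume *: "e \<in> E" "f \<in> H" "e' \<in> E" "f' \<in> H" "tensor e f = tensor e' f'"
    then show "e = e' \<and> f = f'"
      using inner[of e e' f f'] inner[of e e f f] by (auto split: if_splits)
  qed
  show "orthonormal ?T"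
    unfolding orthonormal_def
  proof (intro ballI, elim imageE, clarify)
    fix e f e' f'
    assume *: "e \<in> E" "f \<in> H" "e' \<in> E" "f' \<in> H"
    then have "tensor e f = tensor e' f' \<longleftrightarrow> e = e' \<and> f = f'"
      using inj_on_eq_iff[OF inj, of "(e, f)" "(e', f')"] by simp
    with * show "cinner (tensor e f) (tensor e' f') = (if tensor e f = tensor e' f' then 1 else 0)"
      by (simp add: inner)
  qed
  \<comment> \<open>The span is filled one factor at a time: first an arbitrary left factor against
    a basis vector on the right, then an arbitrary right factor.\<close>
  have x_f: "tensor x f \<in> cspan ?T" if "f \<in> H" for x f
  proof -
    have "tensor x f \<in> (\<lambda>x. tensor x f) ` cspan E" using E by auto
    also have "\<dots> = cspan ((\<lambda>x. tensor x f) ` E)"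
      using L.span_image[of f E] by (simp add: cspan_raw_def)
    also have "\<dots> \<subseteq> cspan ?T" using that by (intro complex_vector.span_mono) auto
    finally show ?thesis .
  qed
  have "tensor x y \<in> cspan ?T" for x y
  proof -
    have "tensor x y \<in> tensor x ` cspan H" using H by auto
    also have "\<dots> = cspan (tensor x ` H)"
      using R.span_image[of x H] by (simp add: cspan_raw_def)
    also have "\<dots> \<subseteq> cspan ?T"
      using x_f by (intro complex_vector.span_minimal) auto
    finally show ?thesis .
  qed
  then have "cspan {tensor x y |x y. True} \<subseteq> cspan ?T"
    by (intro complex_vector.span_minimal) auto
  then show "cspan ?T = UNIV" using t by (auto simp: is_hilbert_tensor_def)
qed

theorem mainTheorem4:
  fixes tensor :: "'a::finite_dim_hilbert \<Rightarrow> 'b::finite_dim_hilbert \<Rightarrow> 'c::finite_dim_hilbert"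
    and A :: "'c \<Rightarrow> 'c"
    and K M :: nat
  assumes "is_hilbert_tensor tensor"
    and "cdim (UNIV :: 'a set) = K" and "K \<ge> 1"
    and "cdim (UNIV :: 'b set) = M" and "M \<ge> 1"
    and "clinear A"
  shows "1 / (of_nat K * of_nat M) * ctrace A \<in> product_numerical_range tensor A"
proof -
  obtain E :: "'a set" where E: "finite E" "orthonormal E" "cspan E = UNIV" "card E = K"
    using exists_orthonormal_basis assms(2) by metis
  obtain H :: "'b set" where H: "finite H" "orthonormal H" "cspan H = UNIV" "card H = M"
    using exists_orthonormal_basis assms(4) by metis
  have ne: "E \<noteq> {}" "H \<noteq> {}" using E H assms by auto
  interpret A: Vector_Spaces.linear scaleC scaleC A by (rule assms)
  interpret R: Vector_Spaces.linear scaleC scaleC "tensor x" for x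
    using assms(1) by (simp add: is_hilbert_tensor_def)
  interpret L: Vector_Spaces.linear scaleC scaleC "\<lambda>x. tensor x y" for y
    using assms(1) by (simp add: is_hilbert_tensor_def)
  note tensor_simps = L.add L.scale R.add R.scale A.add A.scale
    cinner_add_left cinner_add_right cinner_scaleC_left cinner_scaleC_right
  note basis = tensor_orthonormal_basis[OF assms(1) E(1-3) H(1-3)]
  have "ctrace A = (\<Sum>b\<in>case_prod tensor ` (E \<times> H). cinner b (A b))"
    using E H by (intro ctrace_orthonormal assms basis) auto
  also have "\<dots> = (\<Sum>e\<in>E. \<Sum>f\<in>H. cinner (tensor e f) (A (tensor e f)))"
    unfolding sum.reindex[OF basis(2)] sum.cartesian_product by (simp add: case_prod_unfold)
  finally have tr: "ctrace A = \<dots>" .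
  \<comment> \<open>This is the form of the partial trace of \<open>A\<close> over the second
    factor; its diagonal sum over \<open>E\<close> is the full trace.\<close>
  define F where "F x x' = (\<Sum>f\<in>H. cinner (tensor x f) (A (tensor x' f)))" for x x'
  interpret F: sesquilinear F
    by unfold_locales (simp_all add: F_def tensor_simps sum.distrib sum_distrib_left)
  obtain x where x: "cnorm x = 1" "F x x = ctrace A / of_nat K"
    using F.mean_in_numerical_range[OF E(1) ne(1) E(2)] E(4) tr by (auto simp: F_def)
  \<comment> \<open>With \<open>x\<close> now fixed, the diagonal sum of \<open>G\<close> over
    \<open>H\<close> is exactly \<open>F x x\<close>, so the second averaging divides
    \<open>F x x\<close> by \<open>M\<close>.\<close>
  define G where "G y y' = cinner (tensor x y) (A (tensor x y'))" for y y'
  interpret G: sesquilinear G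
    by unfold_locales (simp_all add: G_def tensor_simps)
  obtain y where y: "cnorm y = 1" "G y y = F x x / of_nat M"
    using G.mean_in_numerical_range[OF H(1) ne(2) H(2)] H(4) by (auto simp: F_def G_def)
  have "cinner (tensor x y) (A (tensor x y)) = 1 / (of_nat K * of_nat M) * ctrace A"
    using y(2) x(2) by (simp add: G_def)
  then show ?thesis
    unfolding product_numerical_range_def using x(1) y(1) by force
qed

end
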